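(* Let $\alpha<1$ and let $a$ be a fixed cut-off function as in the context. There are constants $C_1,C_2>0$, independent of $\lambda$, $\gamma$ and $p$, such that for all $\lambda\ge1$ and $\gamma>0$ with $N=\gamma\lambda$ a positive integer, and all $p\in[0,1]$, the random wave $u(x)=\sum_{j=1}^{N}\epsilon_j e^{i\lambda x\cdot\xi_j}$, $x\in\mathbb{R}^2$, with directions $\xi_1,\dots,\xi_N$ equally spaced on the unit circle and independent coefficients $\epsilon_j$ each equal to $+1$ with probability $p$ and $-1$ with probability $1-p$, satisfies $$\sigma^2\left[\|a_\lambda u\|_{L^2}^2\right]\le C_1\lambda^{1-3\alpha}\gamma^2\left(1-(2p-1)^2\right)^2+C_2\gamma^3\lambda^{1-2\alpha}(2p-1)^2\left(1-(2p-1)^2\right).$$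
   Context: The cut-off $a:\mathbb{R}\to\mathbb{R}$ is a fixed smooth function supported on $[-2,2]$ and equal to $1$ on $[-1,1]$. For $x\in\mathbb{R}^2$ put $a_\lambda(x)=a(\lambda^\alpha|x|)$, so $\|a_\lambda u\|_{L^2}^2=\int_{\mathbb{R}^2}a^2(\lambda^\alpha|x|)\,|u(x)|^2\,dx$. The $N=\gamma\lambda$ directions $\xi_j$ lie on the unit circle $\mathbb{S}\subset\mathbb{R}^2$, with angle $2\pi/(\gamma\lambda)$ between consecutive directions. $\sigma^2[Y]=\mathbb{E}[(Y-\mathbb{E}[Y])^2]$ is the variance with respect to the random coefficients. *)

theory Defs
  imports "HOL-Analysis.Analysis" "HOL-Probability.Probability"
begin

definition smooth_cutoff :: "(real \<Rightarrow> real) \<Rightarrow> bool" where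
  "smooth_cutoff a \<longleftrightarrow>
     (\<forall>k x. (deriv ^^ k) a differentiable (at x)) \<and>
     closure {x. a x \<noteq> 0} \<subseteq> {-2..2} \<and>
     (\<forall>x\<in>{-1..1}. a x = 1)"

definition scaled_cutoff :: "(real \<Rightarrow> real) \<Rightarrow> real \<Rightarrow> real \<Rightarrow> real^2 \<Rightarrow> real" where
  "scaled_cutoff a \<alpha> lam x = a (lam powr \<alpha> * norm x)"

text \<open>The position of the first direction on the circle (the angle \<open>\<theta>\<close>) is left free.\<close>

definition equally_spaced_directions :: "nat \<Rightarrow> (nat \<Rightarrow> real^2) \<Rightarrow> bool" where
  "equally_spaced_directions N \<xi> \<longleftrightarrow>
     (\<exists>\<theta>. \<forall>j\<in>{1..N}. \<xi> j = vector [cos (\<theta> + 2 * pi * real j / real N),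
                                      sin (\<theta> + 2 * pi * real j / real N)])"

definition plane_wave_sum ::
  "real \<Rightarrow> nat \<Rightarrow> (nat \<Rightarrow> real^2) \<Rightarrow> (nat \<Rightarrow> real) \<Rightarrow> real^2 \<Rightarrow> complex" where
  "plane_wave_sum lam N \<xi> c x =
     (\<Sum>j=1..N. complex_of_real (c j) * exp (\<i> * complex_of_real (lam * (x \<bullet> \<xi> j))))"

definition L2_norm :: "(real^2 \<Rightarrow> complex) \<Rightarrow> real" where
  "L2_norm f = sqrt (LINT x|lborel. (cmod (f x))\<^sup>2)"

definition random_signs :: "'w measure \<Rightarrow> nat \<Rightarrow> real \<Rightarrow> (nat \<Rightarrow> 'w \<Rightarrow> real) \<Rightarrow> bool" where
  "random_signs M N p \<epsilon> \<longleftrightarrow>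
     prob_space.indep_vars M (\<lambda>_. borel) \<epsilon> {1..N} \<and>
     (\<forall>j\<in>{1..N}. measure M {\<omega>\<in>space M. \<epsilon> j \<omega> = 1} = p \<and>
                  measure M {\<omega>\<in>space M. \<epsilon> j \<omega> = -1} = 1 - p)"

end

theory Submission
  imports Defs
begin

text \<open>Expanding the square, the localised norm is the quadratic form \<open>\<Sum>j k. \<epsilon>\<^sub>j \<epsilon>\<^sub>k A\<^sub>j\<^sub>k\<close> with
  \<open>A\<^sub>j\<^sub>k = \<lambda>\<^bsup>-2\<alpha>\<^esup> F(\<lambda>\<^bsup>1-\<alpha>\<^esup> (\<xi>\<^sub>j - \<xi>\<^sub>k))\<close>, where \<open>F\<close> is the Fourier transform of \<open>a\<^sup>2(|x|)\<close>. With
  \<open>m = 2p - 1\<close> and \<open>\<epsilon>\<^sub>j = m + \<eta>\<^sub>j\<close>, the products of distinct \<open>\<eta>\<^sub>j\<close> are orthogonal, so the variance is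
  \<open>2 (1 - m\<^sup>2)\<^sup>2\<close> times the off-diagonal sum of \<open>A\<^sub>j\<^sub>k\<^sup>2\<close> plus \<open>4 m\<^sup>2 (1 - m\<^sup>2)\<close> times the sum of the squares
  of the off-diagonal row sums. Quadratic decay of \<open>F\<close> and the equal spacing bound every off-diagonal
  absolute row sum by a multiple of \<open>\<gamma> \<lambda>\<^bsup>-\<alpha>\<^esup>\<close>, and every entry by a multiple of \<open>\<lambda>\<^bsup>-2\<alpha>\<^esup>\<close>.\<close>

section \<open>Decay of the Fourier transform of the squared cut-off\<close>

lemma taylor_remainder_bound:
  fixes b b' b'' :: "real \<Rightarrow> real"
  assumes b: "\<And>x. (b has_real_derivative b' x) (at x)"
    and b': "\<And>x. (b' has_real_derivative b'' x) (at x)"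
    and K: "\<And>x. \<bar>b'' x\<bar> \<le> K"
  shows "\<bar>b y - b x - b' x * (y - x)\<bar> \<le> K * (y - x)\<^sup>2"
proof -
  have lip: "\<bar>b' z - b' w\<bar> \<le> K * \<bar>z - w\<bar>" for z w
    using field_differentiable_bound[of UNIV b' b'' K z w] b' K by (auto simp: real_norm_def)
  \<comment> \<open>Removing the linear part leaves the derivative \<open>b' t - b' x\<close>, which
    the Lipschitz bound makes at most \<open>K * \<bar>y - x\<bar>\<close> on the segment. A second
    use of the mean value inequality then gives the quadratic remainder, at the price of the factor
    1/2 of Taylor's formula.\<close>
  define f where "f t = b t - b' x * t" for t
  have f: "(f has_real_derivative (b' t - b' x)) (at t)" for t
    unfolding f_def by (auto intro!: derivative_eq_intros b)
  have "\<bar>f y - f x\<bar> \<le> K * \<bar>y - x\<bar> * \<bar>y - x\<bar>"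
  proof -
    have "\<bar>b' t - b' x\<bar> \<le> K * \<bar>y - x\<bar>" if "t \<in> closed_segment x y" for t
    proof -
      have "\<bar>t - x\<bar> \<le> \<bar>y - x\<bar>"
        using that dist_in_closed_segment[of t x y] by (auto simp: dist_real_def)
      moreover have "K \<ge> 0" using K[of 0] by linarith
      ultimately have "K * \<bar>t - x\<bar> \<le> K * \<bar>y - x\<bar>" by (intro mult_left_mono)
      then show ?thesis using lip[of t x] by linarith
    qed
    then show ?thesis
      using field_differentiable_bound[of "closed_segment x y" f "\<lambda>t. b' t - b' x" "K * \<bar>y - x\<bar>" x y]
        f DERIV_subset[OF f subset_UNIV] by (auto simp: real_norm_def abs_minus_commute)
  qed
  then show ?thesis
    by (simp add: f_def power2_eq_square algebra_simps abs_mult_self_eq)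
qed

lemma continuous_vanishing_bounded:
  fixes f :: "real \<Rightarrow> real"
  assumes "continuous_on UNIV f" "\<And>x. \<bar>x\<bar> > r \<Longrightarrow> f x = 0"
  shows "\<exists>K>0. \<forall>x. \<bar>f x\<bar> \<le> K"
proof -
  have "compact (f ` {-r..r})"
    using assms(1) by (intro compact_continuous_image) (auto intro: continuous_on_subset)
  then obtain K where K: "K > 0" "\<And>y. y \<in> f ` {-r..r} \<Longrightarrow> norm y \<le> K"
    using compact_imp_bounded bounded_pos by metis
  have "\<bar>f x\<bar> \<le> K" for x
    using K(1) K(2)[OF imageI, of x] assms(2)[of x] by (cases "\<bar>x\<bar> > r") (simp_all add: abs_le_iff, linarith)
  with K(1) show ?thesis by auto
qed

text \<open>The triangle inequality makes the second difference nonnegative. From above, the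
  parallelogram law and the nonnegativity of (?p - ?r)^2 + (?m - ?r)^2 give ?r * (?p + ?m - 2 * ?r)
  \<le> (norm h)^2, and staying at distance at least 1 from the kink of the norm at the origin
  allows dropping the factor ?r.\<close>

lemma second_difference_norm_bound:
  fixes x h :: "'a::real_inner"
  assumes "norm x \<ge> 1"
  shows "\<bar>norm (x + h) + norm (x - h) - 2 * norm x\<bar> \<le> (norm h)\<^sup>2"
proof -
  let ?r = "norm x" and ?p = "norm (x + h)" and ?m = "norm (x - h)"
  have "norm (2 *\<^sub>R x) \<le> ?p + ?m"
    using norm_triangle_ineq[of "x + h" "x - h"] by (simp add: scaleR_2)
  then have lo: "2 * ?r \<le> ?p + ?m" by simp
  have par: "?p\<^sup>2 + ?m\<^sup>2 = 2 * ?r\<^sup>2 + 2 * (norm h)\<^sup>2"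
    by (simp add: power2_norm_eq_inner inner_simps algebra_simps inner_commute)
  have "2 * ?r * (?p + ?m - 2 * ?r) \<le> 2 * (norm h)\<^sup>2"
    using par sum_squares_ge_zero[of "?p - ?r" "?m - ?r"]
    by (simp add: power2_eq_square algebra_simps)
  moreover have "2 * 1 * (?p + ?m - 2 * ?r) \<le> 2 * ?r * (?p + ?m - 2 * ?r)"
    using lo assms by (intro mult_right_mono) auto
  ultimately have "2 * 1 * (?p + ?m - 2 * ?r) \<le> 2 * (norm h)\<^sup>2" by (rule order_trans[rotated])
  then show ?thesis using lo by simp
qed

text \<open>Both outer values are expanded by Taylor at \<open>norm x\<close>. The two remainders
  cost \<open>2 * K\<close>; the first-order terms add up to \<open>b'\<close> times the second
  difference of the norm, which costs \<open>L\<close>. Near the origin, where the norm is not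
  smooth, \<open>b'\<close> vanishes and the first-order terms disappear.\<close>

lemma radial_second_difference_bound:
  fixes b b' b'' :: "real \<Rightarrow> real" and x h :: "'a::real_inner"
  assumes b: "\<And>x. (b has_real_derivative b' x) (at x)"
    and b': "\<And>x. (b' has_real_derivative b'' x) (at x)"
    and K: "\<And>x. \<bar>b'' x\<bar> \<le> K" and L: "\<And>x. \<bar>b' x\<bar> \<le> L"
    and flat: "\<And>x. \<bar>x\<bar> < 1 \<Longrightarrow> b' x = 0"
  shows "\<bar>2 * b (norm x) - b (norm (x + h)) - b (norm (x - h))\<bar> \<le> (2 * K + L) * (norm h)\<^sup>2"
proof -
  let ?r = "norm x" and ?p = "norm (x + h)" and ?m = "norm (x - h)"
  have K0: "K \<ge> 0" and L0: "L \<ge> 0" using K[of 0] L[of 0] by linarith+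
  have "\<bar>?p - ?r\<bar> \<le> norm h" "\<bar>?m - ?r\<bar> \<le> norm h"
    using norm_triangle_ineq3[of "x + h" x] norm_triangle_ineq3[of "x - h" x] by auto
  then have "(?p - ?r)\<^sup>2 \<le> (norm h)\<^sup>2" "(?m - ?r)\<^sup>2 \<le> (norm h)\<^sup>2"
    by (simp_all add: abs_le_square_iff[symmetric])
  then have sq: "K * (?p - ?r)\<^sup>2 \<le> K * (norm h)\<^sup>2" "K * (?m - ?r)\<^sup>2 \<le> K * (norm h)\<^sup>2"
    using K0 by (auto intro: mult_left_mono)
  have lin: "\<bar>b' ?r * (?p + ?m - 2 * ?r)\<bar> \<le> L * (norm h)\<^sup>2"
  proof (cases "?r < 1")
    case True
    then show ?thesis using flat[of ?r] L0 by simp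
  next
    case False
    then show ?thesis unfolding abs_mult
      using second_difference_norm_bound[of x h] L L0 by (intro mult_mono) auto
  qed
  have "b' ?r * (?p + ?m - 2 * ?r) = b' ?r * (?p - ?r) + b' ?r * (?m - ?r)"
    by (simp add: algebra_simps)
  with lin sq taylor_remainder_bound[OF b b' K, of ?p ?r] taylor_remainder_bound[OF b b' K, of ?m ?r]
  have "\<bar>2 * b ?r - b ?p - b ?m\<bar> \<le> K * (norm h)\<^sup>2 + K * (norm h)\<^sup>2 + L * (norm h)\<^sup>2"
    by linarith
  then show ?thesis by (simp add: algebra_simps)
qed

section \<open>The cut-off and the derivatives of its square\<close>

lemma smooth_cutoff_vanishes:
  assumes "smooth_cutoff a" "\<bar>x\<bar> > 2"
  shows "a x = 0"
proof (rule ccontr)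
  assume "a x \<noteq> 0"
  then have "x \<in> closure {x. a x \<noteq> 0}" using closure_subset[of "{x. a x \<noteq> 0}"] by auto
  moreover have "closure {x. a x \<noteq> 0} \<subseteq> {-2..2}"
    using assms(1) unfolding smooth_cutoff_def by simp
  ultimately have "x \<in> {-2..2}" by (rule rev_subsetD)
  then show False using assms(2) by auto
qed

text \<open>Supplies the data for the radial second difference bound: the derivatives come from the
  product rule, and they are bounded because they are continuous and vanish outside [-2, 2].\<close>

lemma smooth_cutoff_square_derivatives:
  assumes "smooth_cutoff a"
  obtains b' b'' K where "K > 0"
    "\<And>x. ((\<lambda>x. (a x)\<^sup>2) has_real_derivative b' x) (at x)"
    "\<And>x. (b' has_real_derivative b'' x) (at x)"
    "\<And>x. \<bar>b' x\<bar> \<le> K" "\<And>x. \<bar>b'' x\<bar> \<le> K"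
    "\<And>x. \<bar>x\<bar> < 1 \<Longrightarrow> b' x = 0"
proof -
  define a' where "a' = deriv a"
  define a'' where "a'' = deriv a'"
  have d: "(deriv ^^ k) a differentiable (at x)" for k x
    using assms unfolding smooth_cutoff_def by (elim conjE allE)
  have a: "(a has_real_derivative a' x) (at x)" for x
    using d[of 0 x] by (simp add: a'_def DERIV_deriv_iff_real_differentiable)
  have a': "(a' has_real_derivative a'' x) (at x)" for x
    using d[of 1 x] by (simp add: a'_def a''_def DERIV_deriv_iff_real_differentiable)
  \<comment> \<open>One more order of differentiability makes \<open>a''\<close>, and with it
    \<open>b''\<close>, continuous.\<close>
  have a'': "a'' differentiable (at x)" for x
    using d[of 2 x] by (simp add: a'_def a''_def eval_nat_numeral)
  have cont: "continuous_on UNIV a" "continuous_on UNIV a'" "continuous_on UNIV a''"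
    using DERIV_isCont[OF a] DERIV_isCont[OF a'] differentiable_imp_continuous_within[OF a'']
    by (simp_all add: continuous_at_imp_continuous_on)
  \<comment> \<open>Applied with c = 0 outside [-2, 2] and with c = 1 inside (-1, 1).\<close>
  have const: "a' x = 0" if "open S" "x \<in> S" "\<And>y. y \<in> S \<Longrightarrow> a y = c" for x S c
  proof -
    have "(a has_real_derivative 0) (at x)"
      by (rule has_field_derivative_transform_within_open[of "\<lambda>_. c" 0 x S a])
         (simp_all add: that)
    then show ?thesis by (rule DERIV_unique[OF a])
  qed
  have a0: "a x = 0" if "\<bar>x\<bar> > 2" for x using smooth_cutoff_vanishes[OF assms that] .
  have op: "open {x::real. \<bar>x\<bar> > 2}" "open {x::real. \<bar>x\<bar> < 1}"
    by (intro open_Collect_less continuous_intros)+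
  have a'0: "a' x = 0" if "\<bar>x\<bar> > 2" for x
    using const[OF op(1), of x 0] a0 that by auto
  have flat: "a' x = 0" if "\<bar>x\<bar> < 1" for x
  proof (rule const[OF op(2)])
    show "a y = 1" if "y \<in> {x. \<bar>x\<bar> < 1}" for y
      using assms that unfolding smooth_cutoff_def by (auto simp: abs_less_iff)
  qed (use that in auto)
  define b' where "b' x = 2 * a x * a' x" for x
  define b'' where "b'' x = 2 * (a' x)\<^sup>2 + 2 * a x * a'' x" for x
  have bcont: "continuous_on UNIV b'" "continuous_on UNIV b''"
    unfolding b'_def b''_def using cont by (auto intro!: continuous_intros)
  have b0: "b' x = 0" "b'' x = 0" if "\<bar>x\<bar> > 2" for x
    using a0[OF that] a'0[OF that] by (auto simp: b'_def b''_def)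
  obtain K where K: "K > 0" "\<And>x. \<bar>b' x\<bar> \<le> K"
    using continuous_vanishing_bounded[where r=2, OF bcont(1) b0(1)] by auto
  obtain L where L: "L > 0" "\<And>x. \<bar>b'' x\<bar> \<le> L"
    using continuous_vanishing_bounded[where r=2, OF bcont(2) b0(2)] by auto
  show ?thesis
  proof (rule that[of "max K L" b' b''])
    show "((\<lambda>x. (a x)\<^sup>2) has_real_derivative b' x) (at x)" for x
      unfolding b'_def by (auto intro!: derivative_eq_intros a simp: power2_eq_square)
    show "(b' has_real_derivative b'' x) (at x)" for x
      unfolding b'_def b''_def
      by (auto intro!: derivative_eq_intros a a' simp: power2_eq_square algebra_simps)
  qed (use K L flat in \<open>auto simp: b'_def max.coboundedI1 max.coboundedI2\<close>)
qed

section \<open>Integral estimates and decay of cosine transforms\<close>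

lemma lborel_integral_translation:
  fixes f :: "'a::euclidean_space \<Rightarrow> real"
  assumes "f \<in> borel_measurable borel"
  shows "(LINT x|lborel. f (x + h)) = (LINT x|lborel. f x)"
proof -
  have "(LINT x|lborel. f x) = (LINT x|distr lborel borel ((+) h). f x)"
    by (simp add: lborel_distr_plus)
  also have "\<dots> = (LINT x|lborel. f (h + x))"
    using assms by (subst integral_distr) auto
  finally show ?thesis by (simp add: add.commute)
qed

lemma lborel_integral_scaling:
  fixes f :: "'a::euclidean_space \<Rightarrow> real"
  assumes [measurable]: "f \<in> borel_measurable borel" and "c > 0"
  shows "(LINT x|lborel. f x) = c ^ DIM('a) * (LINT x|lborel. f (c *\<^sub>R x))"
proof -
  have "(LINT x|lborel. f x) =
      (LINT x|density (distr lborel borel (\<lambda>x. 0 + c *\<^sub>R x)) (\<lambda>_. \<bar>c\<bar>^DIM('a)). f x)"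
    using lborel_affine[of c 0] assms(2) by (metis less_irrefl)
  also have "\<dots> = c ^ DIM('a) * (LINT x|lborel. f (c *\<^sub>R x))"
    using assms(2) by (simp add: integral_density integral_distr)
  finally show ?thesis .
qed

lemma integrable_continuous_compact_support:
  fixes f :: "'a::euclidean_space \<Rightarrow> real"
  assumes "continuous_on UNIV f" and "\<And>x. norm x > r \<Longrightarrow> f x = 0"
  shows "integrable lborel f"
proof -
  have "integrable lborel (\<lambda>x. indicator (cball 0 r) x *\<^sub>R f x)"
    using assms(1) by (intro borel_integrable_compact) (auto intro: continuous_on_subset)
  also have "(\<lambda>x. indicator (cball 0 r) x *\<^sub>R f x) = f"
    using assms(2) by (auto simp: indicator_def fun_eq_iff not_le)
  finally show ?thesis .
qed

lemma abs_integral_le_volume: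
  fixes f :: "'a::euclidean_space \<Rightarrow> real"
  assumes cont: "continuous_on UNIV f" and sup: "\<And>x. norm x > r \<Longrightarrow> f x = 0"
    and K: "\<And>x. \<bar>f x\<bar> \<le> K"
  shows "\<bar>LINT x|lborel. f x\<bar> \<le> K * measure lborel (cball (0::'a) r)"
proof -
  have int: "integrable lborel (\<lambda>x. K * indicator (cball (0::'a) r) x)"
    using emeasure_compact_finite[of "cball (0::'a) r"] by (intro integrable_mult_right) simp
  have "\<bar>LINT x|lborel. f x\<bar> \<le> (LINT x|lborel. K * indicator (cball (0::'a) r) x)"
    using integrable_continuous_compact_support[OF cont sup] int
  proof (rule integral_abs_bound_integral)
    show "\<bar>f x\<bar> \<le> K * indicator (cball 0 r) x" for x
      using K[of x] sup[of x] by (auto simp: indicator_def not_le)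
  qed
  then show ?thesis by simp
qed

text \<open>Shifting by \<open>h = (\<pi> / \<parallel>z\<parallel>\<^sup>2) z\<close> flips the sign of \<open>cos (x \<bullet> z)\<close>, so four times the
  transform of \<open>g\<close> at \<open>z\<close> is the transform of a second difference of \<open>g\<close> with step of length
  \<open>\<pi> / \<parallel>z\<parallel>\<close>.\<close>

lemma cosine_transform_decay:
  fixes g :: "'a::euclidean_space \<Rightarrow> real"
  assumes cont: "continuous_on UNIV g" and sup: "\<And>x. norm x > r \<Longrightarrow> g x = 0"
    and B: "\<And>x. \<bar>g x\<bar> \<le> B"
    and K: "\<And>x h. \<bar>2 * g x - g (x + h) - g (x - h)\<bar> \<le> K * (norm h)\<^sup>2"
  obtains C where "C > 0"
    "\<And>z. \<bar>LINT x|lborel. g x * cos (x \<bullet> z)\<bar> \<le> C / (1 + (norm z)\<^sup>2)"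
proof -
  define F where "F z = (LINT x|lborel. g x * cos (x \<bullet> z))" for z
  \<comment> \<open>The enlarged radius accommodates the translates of \<open>g\<close> by steps of
    length at most pi, so one volume serves for all integrals below.\<close>
  define V where "V = measure lborel (cball (0::'a) (r + pi))"
  have B0: "B \<ge> 0" using B[of 0] by linarith
  have V0: "V \<ge> 0" by (simp add: V_def)
  obtain e :: 'a where "norm e = 1" using vector_choose_size[of 1] by auto
  then have K0: "K \<ge> 0" using K[of 0 e] by simp
  have pi0: "r + pi \<ge> r" using pi_ge_zero by linarith
  have mult: "\<bar>y * cos t\<bar> \<le> M" if "\<bar>y\<bar> \<le> M" for y t M :: real
    using mult_mono[OF that abs_cos_le_one[of t]] that by (auto simp: abs_mult)
  have c [continuous_intros]: "continuous_on UNIV (\<lambda>x. g (u x))"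
    if "continuous_on UNIV u" for u :: "'a \<Rightarrow> 'a"
    using continuous_on_compose2[OF cont that] by auto
  have F1: "\<bar>F z\<bar> \<le> B * V" for z
    unfolding F_def V_def
  proof (rule abs_integral_le_volume)
    show "g x * cos (x \<bullet> z) = 0" if "norm x > r + pi" for x
      using sup[of x] that pi0 by simp
  qed (use mult[OF B] in \<open>auto intro!: continuous_intros cont\<close>)
  \<comment> \<open>For \<open>norm z < 1\<close> the shift would be longer than pi, and the trivial
    bound \<open>F1\<close> with (norm z)^2 \<le> 1 \<le> pi^2 is enough. Otherwise the second
    difference bound applies. The sum \<open>B + K\<close> covers both cases with one
    constant.\<close>
  have F2: "(norm z)\<^sup>2 * \<bar>F z\<bar> \<le> pi\<^sup>2 * (B + K) * V" for z
  proof (cases "norm z < 1")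
    case True
    then have "(norm z)\<^sup>2 \<le> 1" by (simp add: abs_square_le_1)
    moreover have "1 \<le> pi\<^sup>2" using pi_ge_two by (simp add: one_le_power)
    ultimately have "(norm z)\<^sup>2 \<le> pi\<^sup>2" by linarith
    then have "(norm z)\<^sup>2 * \<bar>F z\<bar> \<le> pi\<^sup>2 * (B * V)"
      using F1[of z] by (rule mult_mono) simp_all
    also have "\<dots> \<le> pi\<^sup>2 * ((B + K) * V)"
      using K0 V0 by (intro mult_left_mono mult_right_mono) auto
    finally show ?thesis by (simp add: mult.assoc)
  next
    case False
    define h where "h = (pi / (norm z)\<^sup>2) *\<^sub>R z"
    have z0: "norm z > 0" using False by linarith
    have hz: "h \<bullet> z = pi"
      using z0 by (simp add: h_def power2_norm_eq_inner)
    have nh: "norm h = pi / norm z"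
      using z0 by (simp add: h_def power2_eq_square)
    also have "\<dots> \<le> pi" using False by (simp add: divide_le_eq mult_le_cancel_left1)
    finally have nh': "norm h \<le> pi" .
    have supp: "g (x + v) = 0" if "norm x > r + pi" "v = 0 \<or> v = h \<or> v = - h" for x v
    proof (rule sup)
      have "norm v \<le> pi" using that(2) nh' by auto
      then show "norm (x + v) > r" using that(1) norm_diff_ineq[of x v] by linarith
    qed
    have shift: "(LINT x|lborel. g (x + v) * cos (x \<bullet> z)) = - F z" if v: "v = h \<or> v = - h" for v
    proof -
      have "cos ((x + v) \<bullet> z) = - cos (x \<bullet> z)" for x
        using v hz by (auto simp: inner_add_left)
      then have "(LINT x|lborel. g (x + v) * cos (x \<bullet> z))
          = (LINT x|lborel. - (g (x + v) * cos ((x + v) \<bullet> z)))" by simp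
      also have "\<dots> = - F z" unfolding F_def
        by (subst lborel_integral_translation[symmetric, of _ v])
           (auto intro!: borel_measurable_continuous_onI continuous_intros cont)
      finally show ?thesis .
    qed
    have int: "integrable lborel (\<lambda>x. g (x + v) * cos (x \<bullet> z))" if "v = 0 \<or> v = h \<or> v = - h" for v
    proof (rule integrable_continuous_compact_support[of _ "r + pi"])
      show "g (x + v) * cos (x \<bullet> z) = 0" if "norm x > r + pi" for x
        using supp[OF that \<open>v = 0 \<or> v = h \<or> v = - h\<close>] by simp
    qed (auto intro!: continuous_intros)
    have "(LINT x|lborel. (2 * g x - g (x + h) - g (x - h)) * cos (x \<bullet> z))
        = (LINT x|lborel. 2 * (g (x + 0) * cos (x \<bullet> z)) - g (x + h) * cos (x \<bullet> z)
             - g (x + - h) * cos (x \<bullet> z))"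
      by (simp add: algebra_simps)
    also have "\<dots> = 2 * F z - - F z - - F z"
      using int[of 0] int[of h] int[of "-h"] shift[of h] shift[of "- h"]
      by (simp add: F_def del: diff_conv_add_uminus add_uminus_conv_diff)
    finally have eq: "4 * F z = (LINT x|lborel. (2 * g x - g (x + h) - g (x - h)) * cos (x \<bullet> z))"
      by simp
    have "\<bar>4 * F z\<bar> \<le> K * (norm h)\<^sup>2 * V" unfolding eq V_def
    proof (rule abs_integral_le_volume)
      show "(2 * g x - g (x + h) - g (x - h)) * cos (x \<bullet> z) = 0" if "norm x > r + pi" for x
        using supp[OF that, of 0] supp[OF that, of h] supp[OF that, of "- h"] by simp
    qed (use mult[OF K] in \<open>auto intro!: continuous_intros cont\<close>)
    then have "(norm z)\<^sup>2 * \<bar>4 * F z\<bar> \<le> (norm z)\<^sup>2 * (K * (norm h)\<^sup>2 * V)"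
      by (intro mult_left_mono) auto
    also have "\<dots> = pi\<^sup>2 * K * V"
      using z0 by (simp add: nh field_simps)
    also have "\<dots> \<le> pi\<^sup>2 * (B + K) * V"
      using B0 V0 by (intro mult_right_mono mult_left_mono) auto
    finally have "4 * ((norm z)\<^sup>2 * \<bar>F z\<bar>) \<le> pi\<^sup>2 * (B + K) * V" by (simp add: abs_mult)
    moreover have "0 \<le> (norm z)\<^sup>2 * \<bar>F z\<bar>" by simp
    ultimately show ?thesis by linarith
  qed
  \<comment> \<open>Adding \<open>F1\<close> and \<open>F2\<close> bounds \<bar>F z\<bar> * (1 +
    (norm z)^2); the final 1 makes the constant strictly positive.\<close>
  define C where "C = B * V + pi\<^sup>2 * (B + K) * V + 1"
  have "\<bar>F z\<bar> \<le> C / (1 + (norm z)\<^sup>2)" for z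
  proof -
    have pos: "1 + (norm z)\<^sup>2 > 0" using zero_le_power2[of "norm z"] by linarith
    have "\<bar>F z\<bar> * (1 + (norm z)\<^sup>2) \<le> C"
      using F1[of z] F2[of z] by (simp add: C_def algebra_simps)
    then show ?thesis using pos by (simp add: pos_le_divide_eq)
  qed
  moreover have "C > 0" using B0 K0 V0 by (simp add: C_def add_nonneg_pos)
  ultimately show ?thesis using that unfolding F_def by blast
qed

text \<open>The substitution that undoes the scaling by \<open>lam powr \<alpha>\<close> produces
  the Jacobian \<open>lam powr (- 2 * \<alpha>)\<close> in dimension two and moves the frequency
  from \<open>lam * z\<close> to \<open>lam powr (1 - \<alpha>) * z\<close>. The decay constant is
  that of the unscaled function, hence independent of \<open>\<alpha>\<close> and
  \<open>lam\<close>.\<close>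

lemma scaled_cutoff_square_transform_decay:
  assumes a: "smooth_cutoff a"
  obtains C where "C > 0"
    "\<And>\<alpha> lam z. lam > 0 \<Longrightarrow>
      \<bar>LINT x|lborel. (scaled_cutoff a \<alpha> lam x)\<^sup>2 * cos (lam * (x \<bullet> z))\<bar>
        \<le> C * lam powr (- 2 * \<alpha>) / (1 + (lam powr (1 - \<alpha>) * norm z)\<^sup>2)"
proof -
  obtain b' b'' K where K: "K > 0"
    and b': "\<And>x. ((\<lambda>x. (a x)\<^sup>2) has_real_derivative b' x) (at x)"
    and b'': "\<And>x. (b' has_real_derivative b'' x) (at x)"
    and bounds: "\<And>x. \<bar>b' x\<bar> \<le> K" "\<And>x. \<bar>b'' x\<bar> \<le> K"
    and flat: "\<And>x. \<bar>x\<bar> < 1 \<Longrightarrow> b' x = 0"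
    by (rule smooth_cutoff_square_derivatives[OF a]) (rule that)
  have bcont: "continuous_on UNIV (\<lambda>x. (a x)\<^sup>2)"
    using b' by (auto intro!: continuous_at_imp_continuous_on intro: DERIV_isCont)
  note a0 = smooth_cutoff_vanishes[OF a]
  obtain B where B: "\<And>x. \<bar>(a x)\<^sup>2\<bar> \<le> B"
    using continuous_vanishing_bounded[OF bcont, of 2] a0 by auto
  define g where "g x = (a (norm x))\<^sup>2" for x :: "real^2"
  have gcont: "continuous_on UNIV g"
    unfolding g_def by (rule continuous_on_compose2[OF bcont continuous_on_norm_id]) simp
  have g2: "\<bar>2 * g x - g (x + h) - g (x - h)\<bar> \<le> (2 * K + K) * (norm h)\<^sup>2" for x h
    unfolding g_def by (rule radial_second_difference_bound[OF b' b'' bounds(2,1) flat])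
  have g0: "g x = 0" if "norm x > 2" for x using a0 that by (simp add: g_def)
  have gB: "\<bar>g x\<bar> \<le> B" for x unfolding g_def by (rule B)
  obtain C where C: "C > 0"
    "\<And>z. \<bar>LINT x|lborel. g x * cos (x \<bullet> z)\<bar> \<le> C / (1 + (norm z)\<^sup>2)"
    using cosine_transform_decay[OF gcont g0 gB g2] by blast
  have "\<bar>LINT x|lborel. (scaled_cutoff a \<alpha> lam x)\<^sup>2 * cos (lam * (x \<bullet> z))\<bar>
        \<le> C * lam powr (- 2 * \<alpha>) / (1 + (lam powr (1 - \<alpha>) * norm z)\<^sup>2)"
    if lam: "lam > 0" for \<alpha> lam z
  proof -
    let ?w = "(lam powr (1 - \<alpha>)) *\<^sub>R z" and ?c = "lam powr \<alpha>"
    have meas: "(\<lambda>x. g x * cos (x \<bullet> ?w)) \<in> borel_measurable borel"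
      by (intro borel_measurable_continuous_onI continuous_intros gcont)
    have c: "?c * lam powr (1 - \<alpha>) = lam"
      using lam by (simp add: powr_add[symmetric])
    have "(LINT x|lborel. g x * cos (x \<bullet> ?w))
        = ?c ^ DIM(real^2) * (LINT x|lborel. g (?c *\<^sub>R x) * cos ((?c *\<^sub>R x) \<bullet> ?w))"
      using lam by (intro lborel_integral_scaling meas) auto
    also have "(\<lambda>x. g (?c *\<^sub>R x) * cos ((?c *\<^sub>R x) \<bullet> ?w))
        = (\<lambda>x. (scaled_cutoff a \<alpha> lam x)\<^sup>2 * cos (lam * (x \<bullet> z)))"
      using c by (simp add: fun_eq_iff g_def scaled_cutoff_def mult.assoc[symmetric]
        mult.commute[of "lam powr (1 - \<alpha>)"])
    also have "?c ^ DIM(real^2) = lam powr (2 * \<alpha>)"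
      using lam by (simp add: powr_power)
    finally have "(LINT x|lborel. (scaled_cutoff a \<alpha> lam x)\<^sup>2 * cos (lam * (x \<bullet> z)))
        = lam powr (- 2 * \<alpha>) * (LINT x|lborel. g x * cos (x \<bullet> ?w))"
      using lam by (simp add: powr_minus field_simps)
    then have "\<bar>LINT x|lborel. (scaled_cutoff a \<alpha> lam x)\<^sup>2 * cos (lam * (x \<bullet> z))\<bar>
        = lam powr (- 2 * \<alpha>) * \<bar>LINT x|lborel. g x * cos (x \<bullet> ?w)\<bar>"
      by (simp add: abs_mult)
    also have "\<dots> \<le> lam powr (- 2 * \<alpha>) * (C / (1 + (norm ?w)\<^sup>2))"
      by (intro mult_left_mono C) auto
    finally show ?thesis by (simp add: mult.commute)
  qed
  with C(1) show ?thesis using that by blast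
qed

section \<open>Equally spaced directions\<close>

text \<open>Jordan's inequality: sine is concave on [0, pi/2], so its graph lies above the chord
  joining the endpoints.\<close>

lemma sin_pi_mult_ge:
  assumes "0 \<le> t" "t \<le> 1 / 2"
  shows "2 * t \<le> sin (pi * t)"
proof -
  have conv: "convex_on {0..pi/2} (\<lambda>x. - sin x)"
    by (rule f''_ge0_imp_convex[where f' = "\<lambda>x. - cos x" and f'' = sin])
       (auto intro!: derivative_eq_intros sin_ge_zero)
  have "- sin ((1 - 2 * t) *\<^sub>R 0 + (2 * t) *\<^sub>R (pi / 2))
      \<le> (1 - 2 * t) * (- sin 0) + (2 * t) * (- sin (pi / 2))"
    by (rule convex_onD[OF conv]) (use assms in auto)
  then show ?thesis by (simp add: mult.commute)
qed

text \<open>With t = \<bar>j - k\<bar> / N the two directions enclose the angle 2 pi t, whatever the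
  offset \<theta>, and the chord has length 2 sin(pi t). This is symmetric under t -> 1 - t, so
  Jordan's inequality may be applied to the smaller of t and 1 - t; the 4 is the 2 of the chord
  times the 2 of Jordan.\<close>

lemma equally_spaced_directions_norm_diff:
  assumes "equally_spaced_directions N \<xi>" and "j \<in> {1..N}" "k \<in> {1..N}"
  shows "4 * min \<bar>real j - real k\<bar> (real N - \<bar>real j - real k\<bar>) / real N \<le> norm (\<xi> j - \<xi> k)"
proof -
  obtain \<theta> where \<xi>: "\<And>j. j \<in> {1..N} \<Longrightarrow> \<xi> j = vector [cos (\<theta> + 2 * pi * real j / real N),
      sin (\<theta> + 2 * pi * real j / real N)]"
    using assms(1) unfolding equally_spaced_directions_def by auto
  have N: "real N > 0" using assms(2) by auto
  define u where "u = \<theta> + 2 * pi * real j / real N"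
  define w where "w = \<theta> + 2 * pi * real k / real N"
  define t where "t = \<bar>real j - real k\<bar> / real N"
  have t: "0 \<le> t" "t \<le> 1" using assms(2,3) N by (auto simp: t_def divide_le_eq)
  have uw: "\<bar>u - w\<bar> = 2 * (pi * t)"
  proof -
    have "u - w = 2 * pi * ((real j - real k) / real N)"
      by (simp add: u_def w_def diff_divide_distrib right_diff_distrib)
    then show ?thesis using N by (simp add: t_def abs_mult)
  qed
  have "(norm (\<xi> j - \<xi> k))\<^sup>2 = (cos u - cos w)\<^sup>2 + (sin u - sin w)\<^sup>2"
    unfolding \<xi>[OF assms(2)] \<xi>[OF assms(3)] u_def w_def power2_norm_eq_inner inner_vec_def
    by (simp add: sum_2 vector_2 power2_eq_square)
  also have "\<dots> = 2 - 2 * (cos u * cos w + sin u * sin w)"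
    using sin_cos_squared_add[of u] sin_cos_squared_add[of w]
    by (simp add: power2_eq_square algebra_simps)
  also have "\<dots> = 2 - 2 * cos \<bar>u - w\<bar>" by (simp add: cos_diff)
  also have "\<dots> = (2 * sin (pi * t))\<^sup>2"
    unfolding uw using cos_double_sin[of "pi * t"] by (simp add: power_mult_distrib)
  finally have sq: "(norm (\<xi> j - \<xi> k))\<^sup>2 = (2 * sin (pi * t))\<^sup>2" .
  have "0 \<le> sin (pi * t)" using t by (intro sin_ge_zero) (auto simp: mult_left_le)
  then have eq: "norm (\<xi> j - \<xi> k) = 2 * sin (pi * t)"
    by (intro power2_eq_imp_eq[OF sq]) simp_all
  have "2 * min t (1 - t) \<le> sin (pi * t)"
  proof (cases "t \<le> 1 / 2")
    case True
    then show ?thesis using sin_pi_mult_ge[of t] t by linarith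
  next
    case False
    then have "2 * (1 - t) \<le> sin (pi * (1 - t))" using sin_pi_mult_ge[of "1 - t"] t by linarith
    also have "\<dots> = sin (pi * t)" by (simp add: right_diff_distrib)
    finally show ?thesis using False by (simp add: min_def)
  qed
  moreover have "min \<bar>real j - real k\<bar> (real N - \<bar>real j - real k\<bar>) / real N = min t (1 - t)"
    using N by (simp add: t_def min_divide_distrib_right diff_divide_distrib)
  ultimately show ?thesis using eq by simp
qed

section \<open>Row sums over circular index distances\<close>

lemma sum_le_sum_inj_on:
  fixes f :: "'b \<Rightarrow> real"
  assumes "finite B" "inj_on h A" "h ` A \<subseteq> B" "\<And>b. b \<in> B \<Longrightarrow> 0 \<le> f b"
  shows "(\<Sum>a\<in>A. f (h a)) \<le> sum f B"
proof -
  have "(\<Sum>a\<in>A. f (h a)) = sum f (h ` A)" using assms(2) by (simp add: sum.reindex)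
  also have "\<dots> \<le> sum f B" using assms by (intro sum_mono2) auto
  finally show ?thesis .
qed

text \<open>Comparison with the integral of 1 / (1 + x^2): by the mean value theorem, q times a term
  is at most the increment of arctan over the interval of length q ending at the sample point. The
  increments telescope to at most pi/2 < 2. Starting at d = 1 makes the bound valid for every q > 0,
  including large q.\<close>

lemma sum_inverse_one_plus_square_le:
  assumes "q > 0"
  shows "(\<Sum>d=1..n. 1 / (1 + (q * real d)\<^sup>2)) \<le> 2 / q"
proof -
  have step: "q / (1 + (q * real (Suc d))\<^sup>2) \<le> arctan (q * real (Suc d)) - arctan (q * real d)" for d
  proof -
    have lt: "q * real d < q * real (Suc d)" using assms by simp
    obtain z where z: "q * real d < z" "z < q * real (Suc d)"
      "arctan (q * real (Suc d)) - arctan (q * real d)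
        = (q * real (Suc d) - q * real d) * inverse (1 + z\<^sup>2)"
      using MVT2[OF lt, of arctan "\<lambda>x. inverse (1 + x\<^sup>2)"] DERIV_arctan by blast
    have "0 \<le> q * real d" using assms by simp
    then have "z\<^sup>2 \<le> (q * real (Suc d))\<^sup>2" using z by (intro power_mono) auto
    moreover have "0 < 1 + z\<^sup>2" using zero_le_power2[of z] by linarith
    ultimately have "q / (1 + (q * real (Suc d))\<^sup>2) \<le> q / (1 + z\<^sup>2)"
      using assms by (intro divide_left_mono mult_pos_pos) auto
    also have "\<dots> = (q * real (Suc d) - q * real d) * inverse (1 + z\<^sup>2)"
      by (simp add: field_simps)
    finally show ?thesis using z(3) by simp
  qed
  have "(\<Sum>d=1..n. q / (1 + (q * real d)\<^sup>2)) \<le> arctan (q * real n)"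
  proof (induction n)
    case (Suc n)
    then show ?case using step[of n] by simp
  qed simp
  also have "\<dots> \<le> 2" using arctan_ubound[of "q * real n"] pi_less_4 by linarith
  finally have "q * (\<Sum>d=1..n. 1 / (1 + (q * real d)\<^sup>2)) \<le> 2"
    by (simp add: sum_distrib_left)
  then show ?thesis using assms by (simp add: pos_le_divide_eq mult.commute)
qed

text \<open>On either side of j the linear distances d are distinct, hence so are the N - d.
  Replacing the value at the minimum by the sum of the values at d and N - d gives two arctan sums
  per side, four in all, each at most 2 / q. The term k = j would be 1, which is not controlled by 1
  / q.\<close>

lemma circular_distance_sum_le:
  fixes q :: real
  assumes q: "q > 0" and j: "j \<in> {1..N}"
  shows "(\<Sum>k\<in>{1..N} - {j}.
      1 / (1 + (q * min \<bar>real j - real k\<bar> (real N - \<bar>real j - real k\<bar>))\<^sup>2)) \<le> 8 / q"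
proof -
  define f where "f d = 1 / (1 + (q * d)\<^sup>2)" for d :: real
  have f0: "f d \<ge> 0" for d by (simp add: f_def)
  have one_side: "(\<Sum>k\<in>A. f (min \<bar>real j - real k\<bar> (real N - \<bar>real j - real k\<bar>))) \<le> 4 / q"
    if A: "A \<subseteq> {1..N} - {j}" "inj_on (\<lambda>k. nat \<bar>int j - int k\<bar>) A" for A
  proof -
    define \<delta> where "\<delta> k = nat \<bar>int j - int k\<bar>" for k
    have \<delta>: "real (\<delta> k) = \<bar>real j - real k\<bar>" for k by (simp add: \<delta>_def)
    \<comment> \<open>Distinct indices in {1..N} differ by at least 1 and at most N - 1, so the
      subtraction \<open>N - \<delta> k\<close> on naturals is exact and its value is again at least
      1.\<close>
    have \<delta>A: "\<delta> k \<in> {1..N}" "N - \<delta> k \<in> {1..N}" "\<delta> k \<le> N" if "k \<in> A" for k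
    proof -
      have "1 \<le> k" "k \<le> N" "k \<noteq> j" "1 \<le> j" "j \<le> N" using that A(1) j by auto
      then have "1 \<le> \<bar>int j - int k\<bar>" "\<bar>int j - int k\<bar> \<le> int N - 1" by linarith+
      then show "\<delta> k \<in> {1..N}" "N - \<delta> k \<in> {1..N}" "\<delta> k \<le> N" by (auto simp: \<delta>_def)
    qed
    have "(\<Sum>k\<in>A. f (min \<bar>real j - real k\<bar> (real N - \<bar>real j - real k\<bar>)))
        \<le> (\<Sum>k\<in>A. f (real (\<delta> k)) + f (real (N - \<delta> k)))"
    proof (rule sum_mono)
      fix k assume "k \<in> A"
      then have "real (N - \<delta> k) = real N - real (\<delta> k)" using \<delta>A(3) by (simp add: of_nat_diff)
      then show "f (min \<bar>real j - real k\<bar> (real N - \<bar>real j - real k\<bar>))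
          \<le> f (real (\<delta> k)) + f (real (N - \<delta> k))"
        using f0 unfolding \<delta>[symmetric] by (auto simp: min_def)
    qed
    also have "\<dots> = (\<Sum>k\<in>A. f (real (\<delta> k))) + (\<Sum>k\<in>A. f (real (N - \<delta> k)))"
      by (rule sum.distrib)
    also have "\<dots> \<le> (\<Sum>d=1..N. f (real d)) + (\<Sum>d=1..N. f (real d))"
    proof (rule add_mono)
      have inj: "inj_on \<delta> A" using A(2) by (simp add: \<delta>_def[abs_def])
      show "(\<Sum>k\<in>A. f (real (\<delta> k))) \<le> (\<Sum>d=1..N. f (real d))"
        by (rule sum_le_sum_inj_on[OF _ inj]) (use \<delta>A f0 in auto)
      have "inj_on (\<lambda>k. N - \<delta> k) A"
      proof (rule inj_onI)
        fix k l assume "k \<in> A" "l \<in> A" "N - \<delta> k = N - \<delta> l"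
        then have "\<delta> k = \<delta> l" using \<delta>A(3)[of k] \<delta>A(3)[of l] by linarith
        then show "k = l" using inj \<open>k \<in> A\<close> \<open>l \<in> A\<close> by (simp add: inj_on_def)
      qed
      then show "(\<Sum>k\<in>A. f (real (N - \<delta> k))) \<le> (\<Sum>d=1..N. f (real d))"
        by (rule sum_le_sum_inj_on[where h = "\<lambda>k. N - \<delta> k", rotated])
           (use \<delta>A(2) f0 in auto)
    qed
    also have "\<dots> \<le> 2 / q + 2 / q"
      unfolding f_def by (intro add_mono sum_inverse_one_plus_square_le q)
    finally show ?thesis by simp
  qed
  have split: "{1..N} - {j} = {1..<j} \<union> {j<..N}" using j by auto
  have "(\<Sum>k\<in>{1..N} - {j}. f (min \<bar>real j - real k\<bar> (real N - \<bar>real j - real k\<bar>)))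
      = (\<Sum>k\<in>{1..<j}. f (min \<bar>real j - real k\<bar> (real N - \<bar>real j - real k\<bar>)))
      + (\<Sum>k\<in>{j<..N}. f (min \<bar>real j - real k\<bar> (real N - \<bar>real j - real k\<bar>)))"
    unfolding split by (rule sum.union_disjoint) auto
  also have "\<dots> \<le> 4 / q + 4 / q"
    by (intro add_mono one_side) (use j in \<open>auto simp: inj_on_def\<close>)
  finally show ?thesis by (simp add: f_def)
qed

section \<open>Variance of a quadratic form in random signs\<close>

context prob_space
begin

text \<open>Grouped by index, the two monomials form one product of independent factors over S
  \<union> T: an index in both sets contributes the second moment v, an index in just one of them
  contributes the mean 0. The choice T = {} yields the mean of a single monomial.\<close>

lemma indep_centered_prod_orthogonal:
  fixes \<eta> :: "'i \<Rightarrow> 'a \<Rightarrow> real"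
  assumes fin: "finite I" and ind: "indep_vars (\<lambda>_. borel) \<eta> I"
    and int: "\<And>i. i \<in> I \<Longrightarrow> integrable M (\<eta> i)" "\<And>i. i \<in> I \<Longrightarrow> integrable M (\<lambda>\<omega>. (\<eta> i \<omega>)\<^sup>2)"
    and mean: "\<And>i. i \<in> I \<Longrightarrow> expectation (\<eta> i) = 0"
    and var: "\<And>i. i \<in> I \<Longrightarrow> expectation (\<lambda>\<omega>. (\<eta> i \<omega>)\<^sup>2) = v"
    and sub: "S \<subseteq> I" "T \<subseteq> I"
  shows "expectation (\<lambda>\<omega>. (\<Prod>i\<in>S. \<eta> i \<omega>) * (\<Prod>i\<in>T. \<eta> i \<omega>)) = (if S = T then v ^ card S else 0)"
    and "integrable M (\<lambda>\<omega>. (\<Prod>i\<in>S. \<eta> i \<omega>) * (\<Prod>i\<in>T. \<eta> i \<omega>))"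
proof -
  define Y where "Y i x = (if i \<in> S then x else 1) * (if i \<in> T then x else 1)" for i and x :: real
  have finST: "finite S" "finite T" using fin sub finite_subset by auto
  have prod: "(\<Prod>i\<in>S. \<eta> i \<omega>) * (\<Prod>i\<in>T. \<eta> i \<omega>) = (\<Prod>i\<in>S \<union> T. Y i (\<eta> i \<omega>))" for \<omega>
  proof -
    have "(\<Prod>i\<in>S. \<eta> i \<omega>) = (\<Prod>i\<in>S \<union> T. if i \<in> S then \<eta> i \<omega> else 1)"
      using finST by (intro prod.mono_neutral_cong_left) auto
    moreover have "(\<Prod>i\<in>T. \<eta> i \<omega>) = (\<Prod>i\<in>S \<union> T. if i \<in> T then \<eta> i \<omega> else 1)"
      using finST by (intro prod.mono_neutral_cong_left) auto
    ultimately show ?thesis by (simp add: Y_def prod.distrib)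
  qed
  have ind': "indep_vars (\<lambda>_. borel) (\<lambda>i \<omega>. Y i (\<eta> i \<omega>)) (S \<union> T)"
    by (rule indep_vars_compose2[OF indep_vars_subset[OF ind]]) (use sub in \<open>auto simp: Y_def\<close>)
  have Y: "integrable M (\<lambda>\<omega>. Y i (\<eta> i \<omega>)) \<and>
      expectation (\<lambda>\<omega>. Y i (\<eta> i \<omega>)) = (if i \<in> S \<inter> T then v else 0)" if "i \<in> S \<union> T" for i
  proof (cases "i \<in> S \<inter> T")
    case True
    then have "(\<lambda>\<omega>. Y i (\<eta> i \<omega>)) = (\<lambda>\<omega>. (\<eta> i \<omega>)\<^sup>2)" by (auto simp: Y_def power2_eq_square)
    then show ?thesis using True int(2) var sub by auto
  next
    case False
    then have "(\<lambda>\<omega>. Y i (\<eta> i \<omega>)) = \<eta> i" using that by (auto simp: Y_def)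
    then show ?thesis using False that int(1) mean sub by auto
  qed
  note int_prod = indep_vars_integrable[OF _ ind'] indep_vars_lebesgue_integral[OF _ ind']
  show "integrable M (\<lambda>\<omega>. (\<Prod>i\<in>S. \<eta> i \<omega>) * (\<Prod>i\<in>T. \<eta> i \<omega>))"
    unfolding prod using Y finST by (intro int_prod) auto
  have "expectation (\<lambda>\<omega>. (\<Prod>i\<in>S. \<eta> i \<omega>) * (\<Prod>i\<in>T. \<eta> i \<omega>))
      = (\<Prod>i\<in>S \<union> T. if i \<in> S \<inter> T then v else 0)"
    unfolding prod using Y finST by (subst int_prod) (auto intro!: prod.cong)
  also have "\<dots> = (if S = T then v ^ card S else 0)"
  proof (cases "S = T")
    case True
    then show ?thesis by simp
  next
    case False
    then obtain i where "i \<in> S \<union> T" "i \<notin> S \<inter> T" by blast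
    then show ?thesis using False finST by (auto intro!: prod_zero)
  qed
  finally show "expectation (\<lambda>\<omega>. (\<Prod>i\<in>S. \<eta> i \<omega>) * (\<Prod>i\<in>T. \<eta> i \<omega>))
      = (if S = T then v ^ card S else 0)" .
qed

text \<open>The pair \<open>(j, j)\<close> indexes the singleton \<open>{j}\<close>, so \<open>c\<close> collects the linear part on its diagonal
  and the bilinear part off the diagonal; each off-diagonal product occurs twice.\<close>

lemma expectation_square_pair_sum:
  fixes \<eta> :: "'i \<Rightarrow> 'a \<Rightarrow> real" and c :: "'i \<Rightarrow> 'i \<Rightarrow> real"
  assumes fin: "finite I" and ind: "indep_vars (\<lambda>_. borel) \<eta> I"
    and int: "\<And>i. i \<in> I \<Longrightarrow> integrable M (\<eta> i)" "\<And>i. i \<in> I \<Longrightarrow> integrable M (\<lambda>\<omega>. (\<eta> i \<omega>)\<^sup>2)"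
    and mean: "\<And>i. i \<in> I \<Longrightarrow> expectation (\<eta> i) = 0"
    and var: "\<And>i. i \<in> I \<Longrightarrow> expectation (\<lambda>\<omega>. (\<eta> i \<omega>)\<^sup>2) = v"
    and sym: "\<And>j k. c j k = c k j"
  defines "R \<equiv> \<lambda>\<omega>. \<Sum>j\<in>I. \<Sum>k\<in>I. c j k * (\<Prod>i\<in>{j,k}. \<eta> i \<omega>)"
  shows "integrable M R" "expectation R = 0"
    "expectation (\<lambda>\<omega>. (R \<omega>)\<^sup>2) =
      (\<Sum>j\<in>I. \<Sum>k\<in>I. (c j k)\<^sup>2 * (if j = k then v else 2 * v\<^sup>2))"
proof -
  note orth = indep_centered_prod_orthogonal[OF fin ind int mean var]
  define X where "X p \<omega> = (\<Prod>i\<in>{fst p, snd p}. \<eta> i \<omega>)" for p \<omega>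
  define d where "d p = c (fst p) (snd p)" for p
  have R: "R \<omega> = (\<Sum>p\<in>I\<times>I. d p * X p \<omega>)" for \<omega>
    by (simp add: R_def X_def d_def sum.cartesian_product case_prod_beta)
  \<comment> \<open>The index set of a pair is nonempty, so comparison with the empty monomial gives
    mean zero.\<close>
  have X1: "integrable M (X p)" "expectation (X p) = 0" if "p \<in> I \<times> I" for p
    using orth[of "{fst p, snd p}" "{}"] that by (auto simp: X_def[abs_def])
  show "integrable M R" "expectation R = 0" using X1 by (simp_all add: R[abs_def])
  have X2: "integrable M (\<lambda>\<omega>. X p \<omega> * X p' \<omega>)"
    "expectation (\<lambda>\<omega>. X p \<omega> * X p' \<omega>)
      = (if {fst p, snd p} = {fst p', snd p'} then v ^ card {fst p, snd p} else 0)"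
    if "p \<in> I \<times> I" "p' \<in> I \<times> I" for p p'
    using orth[of "{fst p, snd p}" "{fst p', snd p'}"] that unfolding X_def
    by (simp_all add: mem_Times_iff)
  have "expectation (\<lambda>\<omega>. (R \<omega>)\<^sup>2)
      = expectation (\<lambda>\<omega>. \<Sum>p\<in>I\<times>I. \<Sum>p'\<in>I\<times>I. (d p * d p') * (X p \<omega> * X p' \<omega>))"
    by (simp add: R power2_eq_square sum_product mult.assoc mult.left_commute)
  also have "\<dots> = (\<Sum>p\<in>I\<times>I. \<Sum>p'\<in>I\<times>I. (d p * d p') * expectation (\<lambda>\<omega>. X p \<omega> * X p' \<omega>))"
    using X2(1) by simp
  also have "\<dots> = (\<Sum>p\<in>I\<times>I. (d p)\<^sup>2 * (if fst p = snd p then v else 2 * v\<^sup>2))"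
  proof (rule sum.cong[OF refl])
    fix p assume p: "p \<in> I \<times> I"
    obtain j k where jk: "p = (j, k)" "j \<in> I" "k \<in> I" using p by auto
    have "(\<Sum>p'\<in>I\<times>I. (d p * d p') * expectation (\<lambda>\<omega>. X p \<omega> * X p' \<omega>))
        = (\<Sum>p'\<in>I\<times>I. if {j, k} = {fst p', snd p'} then d p * d p' * v ^ card {j, k} else 0)"
      using p by (intro sum.cong refl) (simp add: X2(2) jk)
    also have "\<dots> = (\<Sum>p'\<in>{p'\<in>I\<times>I. {j, k} = {fst p', snd p'}}. d p * d p' * v ^ card {j, k})"
      using fin by (intro sum.inter_filter[symmetric]) simp
    \<comment> \<open>For j = k the two pairs coincide and the sum has a single term with
      \<open>v ^ 1\<close>; otherwise it has two equal terms with \<open>v ^ 2\<close>, by the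
      symmetry of \<open>c\<close>.\<close>
    also have "{p'\<in>I\<times>I. {j, k} = {fst p', snd p'}} = {(j, k), (k, j)}"
      using jk by (auto simp: doubleton_eq_iff)
    also have "(\<Sum>p'\<in>{(j, k), (k, j)}. d p * d p' * v ^ card {j, k})
        = (d p)\<^sup>2 * (if fst p = snd p then v else 2 * v\<^sup>2)"
      using sym[of j k] by (simp add: jk d_def power2_eq_square)
    finally show "(\<Sum>p'\<in>I\<times>I. (d p * d p') * expectation (\<lambda>\<omega>. X p \<omega> * X p' \<omega>))
        = (d p)\<^sup>2 * (if fst p = snd p then v else 2 * v\<^sup>2)" .
  qed
  finally show "expectation (\<lambda>\<omega>. (R \<omega>)\<^sup>2) =
      (\<Sum>j\<in>I. \<Sum>k\<in>I. (c j k)\<^sup>2 * (if j = k then v else 2 * v\<^sup>2))"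
    by (simp add: d_def sum.cartesian_product case_prod_beta)
qed

text \<open>Almost surely the form equals a constant \<open>K\<close> plus a combination
  \<open>R\<close> of centered monomials of degree one and two. \<open>R\<close> has mean zero, so
  the variance is its second moment, which orthogonality evaluates.\<close>

lemma variance_sign_quadratic_form:
  fixes \<epsilon> :: "'i \<Rightarrow> 'a \<Rightarrow> real" and A :: "'i \<Rightarrow> 'i \<Rightarrow> real"
  assumes fin: "finite I" and ind: "indep_vars (\<lambda>_. borel) \<epsilon> I"
    and one: "\<And>i. i \<in> I \<Longrightarrow> AE \<omega> in M. (\<epsilon> i \<omega>)\<^sup>2 = 1"
    and mean: "\<And>i. i \<in> I \<Longrightarrow> expectation (\<epsilon> i) = m"
    and sym: "\<And>j k. A j k = A k j"
  shows "variance (\<lambda>\<omega>. \<Sum>j\<in>I. \<Sum>k\<in>I. \<epsilon> j \<omega> * \<epsilon> k \<omega> * A j k)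
    = 2 * (1 - m\<^sup>2)\<^sup>2 * (\<Sum>j\<in>I. \<Sum>k\<in>I - {j}. (A j k)\<^sup>2)
      + 4 * m\<^sup>2 * (1 - m\<^sup>2) * (\<Sum>j\<in>I. (\<Sum>k\<in>I - {j}. A j k)\<^sup>2)"
proof -
  define Q where "Q \<omega> = (\<Sum>j\<in>I. \<Sum>k\<in>I. \<epsilon> j \<omega> * \<epsilon> k \<omega> * A j k)" for \<omega>
  define \<eta> where "\<eta> i \<omega> = \<epsilon> i \<omega> - m" for i \<omega>
  define A0 where "A0 j k = (if j = k then 0 else A j k)" for j k
  define B where "B j = (\<Sum>k\<in>I. A0 j k)" for j
  \<comment> \<open>The diagonal carries the coefficient of \<open>\<eta> j\<close>: either factor
    of a product of two signs can contribute its mean m, and the symmetry of \<open>A\<close> merges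
    the two contributions into twice the off-diagonal row sum.\<close>
  define c where "c j k = (if j = k then 2 * m * B j else A j k)" for j k
  define K where "K = (\<Sum>j\<in>I. A j j) + m\<^sup>2 * (\<Sum>j\<in>I. B j)"
  define R where "R = (\<lambda>\<omega>. \<Sum>j\<in>I. \<Sum>k\<in>I. c j k * (\<Prod>i\<in>{j,k}. \<eta> i \<omega>))"
  have B: "B j = (\<Sum>k\<in>I - {j}. A j k)" if "j \<in> I" for j
    unfolding B_def using fin that by (intro sum.mono_neutral_cong_right) (auto simp: A0_def)
  have rv: "random_variable borel (\<epsilon> i)" if "i \<in> I" for i
    using ind that unfolding indep_vars_def by auto
  have bnd: "AE \<omega> in M. \<bar>\<epsilon> i \<omega>\<bar> \<le> 1" if "i \<in> I" for i
    using one[OF that] by eventually_elim (simp add: abs_square_le_1[symmetric])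
  have int\<epsilon>: "integrable M (\<epsilon> i)" if "i \<in> I" for i
    using bnd[OF that] rv[OF that] by (intro integrable_const_bound[where B = 1]) auto
  \<comment> \<open>The square is affine in the sign, so its mean is 1 + m^2 - 2 m^2 = 1 -
    m^2.\<close>
  have eta2: "AE \<omega> in M. (\<eta> i \<omega>)\<^sup>2 = 1 + m\<^sup>2 - 2 * m * \<epsilon> i \<omega>" if "i \<in> I" for i
    using one[OF that] by eventually_elim (simp add: \<eta>_def power2_diff)
  have rv\<eta>: "random_variable borel (\<eta> i)" if "i \<in> I" for i
    using rv[OF that] unfolding \<eta>_def by measurable
  have var: "integrable M (\<lambda>\<omega>. (\<eta> i \<omega>)\<^sup>2)" "expectation (\<lambda>\<omega>. (\<eta> i \<omega>)\<^sup>2) = 1 - m\<^sup>2" if "i \<in> I" for i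
  proof -
    have meas: "(\<lambda>\<omega>. (\<eta> i \<omega>)\<^sup>2) \<in> borel_measurable M"
      "(\<lambda>\<omega>. 1 + m\<^sup>2 - 2 * m * \<epsilon> i \<omega>) \<in> borel_measurable M"
      using rv\<eta>[OF that] rv[OF that] by measurable
    show "integrable M (\<lambda>\<omega>. (\<eta> i \<omega>)\<^sup>2)"
      using integrable_cong_AE[OF meas eta2[OF that]] int\<epsilon>[OF that] by simp
    show "expectation (\<lambda>\<omega>. (\<eta> i \<omega>)\<^sup>2) = 1 - m\<^sup>2"
      using integral_cong_AE[OF meas eta2[OF that]] int\<epsilon>[OF that] mean[OF that]
      by (simp add: prob_space power2_eq_square)
  qed
  have ind\<eta>: "indep_vars (\<lambda>_. borel) \<eta> I"
    unfolding \<eta>_def by (rule indep_vars_compose2[OF ind]) auto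
  have int\<eta>: "integrable M (\<eta> i)" "expectation (\<eta> i) = 0" if "i \<in> I" for i
    using int\<epsilon>[OF that] mean[OF that] by (auto simp: \<eta>_def[abs_def] prob_space)
  have csym: "c j k = c k j" for j k using sym by (auto simp: c_def)
  note R2 = expectation_square_pair_sum[where c = c, OF fin ind\<eta> int\<eta>(1) var(1) int\<eta>(2) var(2) csym,
      folded R_def]
  have QR: "AE \<omega> in M. Q \<omega> = K + R \<omega>"
  proof -
    have "AE \<omega> in M. \<forall>i\<in>I. (\<epsilon> i \<omega>)\<^sup>2 = 1" using fin one by (intro AE_finite_allI)
    then show ?thesis
    proof eventually_elim
      fix \<omega> assume sq: "\<forall>i\<in>I. (\<epsilon> i \<omega>)\<^sup>2 = 1"
      have symA0: "A0 j k = A0 k j" for j k using sym by (auto simp: A0_def)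
      \<comment> \<open>Squares of signs being 1, the diagonal is deterministic and is absorbed into
        \<open>K\<close>. With the zero diagonal of \<open>A0\<close> the rest can be summed over
        all pairs.\<close>
      have "Q \<omega> = (\<Sum>j\<in>I. \<Sum>k\<in>I. (if j = k then A j j else 0) + \<epsilon> j \<omega> * \<epsilon> k \<omega> * A0 j k)"
        unfolding Q_def using sq by (intro sum.cong refl) (auto simp: A0_def power2_eq_square)
      also have "\<dots> = (\<Sum>j\<in>I. A j j) + (\<Sum>j\<in>I. \<Sum>k\<in>I. \<epsilon> j \<omega> * \<epsilon> k \<omega> * A0 j k)"
        using fin by (simp add: sum.distrib)
      also have "(\<Sum>j\<in>I. \<Sum>k\<in>I. \<epsilon> j \<omega> * \<epsilon> k \<omega> * A0 j k)
          = (\<Sum>j\<in>I. \<Sum>k\<in>I. m\<^sup>2 * A0 j k + m * (\<eta> j \<omega> * A0 j k) + m * (\<eta> k \<omega> * A0 k j)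
              + \<eta> j \<omega> * \<eta> k \<omega> * A0 j k)"
        by (intro sum.cong refl) (simp add: \<eta>_def power2_eq_square algebra_simps symA0)
      also have "\<dots> = m\<^sup>2 * (\<Sum>j\<in>I. B j) + m * (\<Sum>j\<in>I. \<eta> j \<omega> * B j)
            + m * (\<Sum>j\<in>I. \<Sum>k\<in>I. \<eta> k \<omega> * A0 k j) + (\<Sum>j\<in>I. \<Sum>k\<in>I. \<eta> j \<omega> * \<eta> k \<omega> * A0 j k)"
        by (simp add: sum.distrib B_def sum_distrib_left)
      also have "(\<Sum>j\<in>I. \<Sum>k\<in>I. \<eta> k \<omega> * A0 k j) = (\<Sum>j\<in>I. \<eta> j \<omega> * B j)"
        unfolding B_def sum_distrib_left by (rule sum.swap)
      finally have Q: "Q \<omega> = K + (2 * m * (\<Sum>j\<in>I. \<eta> j \<omega> * B j)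
          + (\<Sum>j\<in>I. \<Sum>k\<in>I. \<eta> j \<omega> * \<eta> k \<omega> * A0 j k))"
        by (simp add: K_def)
      have "R \<omega> = (\<Sum>j\<in>I. \<Sum>k\<in>I. (if j = k then 2 * m * B j * \<eta> j \<omega> else 0)
          + \<eta> j \<omega> * \<eta> k \<omega> * A0 j k)"
        unfolding R_def by (intro sum.cong refl) (simp add: c_def A0_def)
      also have "\<dots> = 2 * m * (\<Sum>j\<in>I. \<eta> j \<omega> * B j) + (\<Sum>j\<in>I. \<Sum>k\<in>I. \<eta> j \<omega> * \<eta> k \<omega> * A0 j k)"
        using fin by (simp add: sum.distrib sum_distrib_left mult_ac)
      finally show "Q \<omega> = K + R \<omega>" using Q by simp
    qed
  qed
  have measQ: "Q \<in> borel_measurable M"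
    unfolding Q_def using rv by (intro borel_measurable_sum borel_measurable_times) auto
  have measR: "R \<in> borel_measurable M" using R2(1) by auto
  have EQ: "expectation Q = K"
    using integral_cong_AE[OF measQ _ QR] measR R2(1,2) by (simp add: prob_space)
  have "variance Q = expectation (\<lambda>\<omega>. (R \<omega>)\<^sup>2)"
  proof (rule integral_cong_AE)
    show "AE \<omega> in M. (Q \<omega> - expectation Q)\<^sup>2 = (R \<omega>)\<^sup>2"
      using QR by eventually_elim (simp add: EQ)
  qed (use measQ measR in measurable)
  also have "\<dots> = (\<Sum>j\<in>I. \<Sum>k\<in>I. (c j k)\<^sup>2 * (if j = k then 1 - m\<^sup>2 else 2 * (1 - m\<^sup>2)\<^sup>2))"
    unfolding R_def by (rule R2(3))
  also have "\<dots> = (\<Sum>j\<in>I. 4 * m\<^sup>2 * (1 - m\<^sup>2) * (B j)\<^sup>2 + 2 * (1 - m\<^sup>2)\<^sup>2 * (\<Sum>k\<in>I - {j}. (A j k)\<^sup>2))"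
  proof (rule sum.cong[OF refl])
    fix j assume j: "j \<in> I"
    have "(\<Sum>k\<in>I. (c j k)\<^sup>2 * (if j = k then 1 - m\<^sup>2 else 2 * (1 - m\<^sup>2)\<^sup>2))
        = (c j j)\<^sup>2 * (1 - m\<^sup>2)
          + (\<Sum>k\<in>I - {j}. (c j k)\<^sup>2 * (if j = k then 1 - m\<^sup>2 else 2 * (1 - m\<^sup>2)\<^sup>2))"
      using fin j by (subst sum.remove[of I j]) auto
    also have "(\<Sum>k\<in>I - {j}. (c j k)\<^sup>2 * (if j = k then 1 - m\<^sup>2 else 2 * (1 - m\<^sup>2)\<^sup>2))
        = (\<Sum>k\<in>I - {j}. 2 * (1 - m\<^sup>2)\<^sup>2 * (A j k)\<^sup>2)"
      by (intro sum.cong refl) (auto simp: c_def)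
    also have "(c j j)\<^sup>2 * (1 - m\<^sup>2) = 4 * m\<^sup>2 * (1 - m\<^sup>2) * (B j)\<^sup>2"
      by (simp add: c_def power_mult_distrib)
    finally show "(\<Sum>k\<in>I. (c j k)\<^sup>2 * (if j = k then 1 - m\<^sup>2 else 2 * (1 - m\<^sup>2)\<^sup>2))
        = 4 * m\<^sup>2 * (1 - m\<^sup>2) * (B j)\<^sup>2 + 2 * (1 - m\<^sup>2)\<^sup>2 * (\<Sum>k\<in>I - {j}. (A j k)\<^sup>2)"
      by (simp add: sum_distrib_left)
  qed
  also have "\<dots> = 2 * (1 - m\<^sup>2)\<^sup>2 * (\<Sum>j\<in>I. \<Sum>k\<in>I - {j}. (A j k)\<^sup>2)
      + 4 * m\<^sup>2 * (1 - m\<^sup>2) * (\<Sum>j\<in>I. (B j)\<^sup>2)"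
    by (simp add: sum.distrib sum_distrib_left)
  also have "(\<Sum>j\<in>I. (B j)\<^sup>2) = (\<Sum>j\<in>I. (\<Sum>k\<in>I - {j}. A j k)\<^sup>2)"
    using B by simp
  finally show ?thesis unfolding Q_def .
qed

text \<open>The prescribed probabilities of the values 1 and -1 add up to 1, so no other value
  occurs outside a null set, and the coefficient is almost surely the difference of two
  indicators.\<close>

lemma random_signs_moments:
  assumes "random_signs M N p \<epsilon>" "i \<in> {1..N}"
  shows "AE \<omega> in M. (\<epsilon> i \<omega>)\<^sup>2 = 1" and "expectation (\<epsilon> i) = 2 * p - 1"
proof -
  have rv [measurable]: "random_variable borel (\<epsilon> i)"
    using assms unfolding random_signs_def indep_vars_def by auto
  define P where "P = {\<omega>\<in>space M. \<epsilon> i \<omega> = 1}"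
  define M' where "M' = {\<omega>\<in>space M. \<epsilon> i \<omega> = - 1}"
  have ev [measurable]: "P \<in> events" "M' \<in> events" unfolding P_def M'_def by measurable
  have pr: "prob P = p" "prob M' = 1 - p"
    using assms unfolding random_signs_def P_def M'_def by auto
  have "prob (P \<union> M') = 1"
    using pr ev by (subst finite_measure_Union) (auto simp: P_def M'_def)
  then have PM: "AE \<omega> in M. \<omega> \<in> P \<union> M'" by (rule AE_prob_1)
  then show "AE \<omega> in M. (\<epsilon> i \<omega>)\<^sup>2 = 1"
    by eventually_elim (auto simp: P_def M'_def)
  have "AE \<omega> in M. \<epsilon> i \<omega> = indicator P \<omega> - indicator M' \<omega>"
    using PM by eventually_elim (auto simp: P_def M'_def)
  then have "expectation (\<epsilon> i) = expectation (\<lambda>\<omega>. indicator P \<omega> - indicator M' \<omega>)"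
    by (intro integral_cong_AE) auto
  also have "\<dots> = prob P - prob M'" using ev
    by (subst Bochner_Integration.integral_diff) (auto simp: less_top[symmetric])
  finally show "expectation (\<epsilon> i) = 2 * p - 1" using pr by simp
qed

end

section \<open>The variance bound\<close>

text \<open>The coefficients are real, so squaring and adding the real and imaginary parts combines
  the products by the addition formula for the cosine, and only cosines of phase differences
  remain.\<close>

lemma cmod_plane_wave_sum_square:
  "(cmod (plane_wave_sum lam N \<xi> c x))\<^sup>2
    = (\<Sum>j=1..N. \<Sum>k=1..N. c j * c k * cos (lam * (x \<bullet> (\<xi> j - \<xi> k))))"
proof -
  define t where "t j = lam * (x \<bullet> \<xi> j)" for j
  have "plane_wave_sum lam N \<xi> c x = (\<Sum>j=1..N. of_real (c j) * cis (t j))"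
    by (simp add: plane_wave_sum_def t_def cis_conv_exp)
  then have "Re (plane_wave_sum lam N \<xi> c x) = (\<Sum>j=1..N. c j * cos (t j))"
    "Im (plane_wave_sum lam N \<xi> c x) = (\<Sum>j=1..N. c j * sin (t j))" by simp_all
  then have "(cmod (plane_wave_sum lam N \<xi> c x))\<^sup>2
      = (\<Sum>j=1..N. c j * cos (t j))\<^sup>2 + (\<Sum>j=1..N. c j * sin (t j))\<^sup>2"
    by (simp add: cmod_power2)
  also have "\<dots> = (\<Sum>j=1..N. \<Sum>k=1..N. c j * c k * cos (t j - t k))"
    by (simp add: power2_eq_square sum_product sum.distrib[symmetric] cos_diff algebra_simps)
  finally show ?thesis by (simp add: t_def inner_diff_right right_diff_distrib)
qed

lemma integrable_scaled_cutoff_square_cos: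
  assumes a: "smooth_cutoff a" and lam: "lam > 0"
  shows "integrable lborel (\<lambda>x. (scaled_cutoff a \<alpha> lam x)\<^sup>2 * cos (lam * (x \<bullet> z)))"
proof (rule integrable_continuous_compact_support)
  have "a differentiable (at x)" for x
  proof -
    have "(deriv ^^ 0) a differentiable (at x)"
      using a unfolding smooth_cutoff_def by (elim conjE allE)
    then show ?thesis by simp
  qed
  then have acont: "continuous_on UNIV a"
    using differentiable_imp_continuous_within by (intro continuous_at_imp_continuous_on) auto
  have "continuous_on UNIV (scaled_cutoff a \<alpha> lam)"
    unfolding scaled_cutoff_def[abs_def]
    by (rule continuous_on_compose2[OF acont]) (auto intro!: continuous_intros)
  then show "continuous_on UNIV (\<lambda>x. (scaled_cutoff a \<alpha> lam x)\<^sup>2 * cos (lam * (x \<bullet> z)))"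
    by (intro continuous_intros)
  show "(scaled_cutoff a \<alpha> lam x)\<^sup>2 * cos (lam * (x \<bullet> z)) = 0" if "norm x > 2 / lam powr \<alpha>" for x
  proof -
    have "lam powr \<alpha> * norm x > 2" using that lam by (simp add: divide_less_eq mult.commute)
    then have "scaled_cutoff a \<alpha> lam x = 0"
      unfolding scaled_cutoff_def by (intro smooth_cutoff_vanishes[OF a]) simp
    then show ?thesis by simp
  qed
qed

text \<open>Reduces the localised norm to a quadratic form in the coefficients with a deterministic
  matrix; integrability of each cosine term lets the integral pass through the finite double
  sum.\<close>

lemma L2_norm_cutoff_plane_wave_sum:
  assumes a: "smooth_cutoff a" and lam: "lam > 0"
  shows "(L2_norm (\<lambda>x. complex_of_real (scaled_cutoff a \<alpha> lam x) * plane_wave_sum lam N \<xi> c x))\<^sup>2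
    = (\<Sum>j=1..N. \<Sum>k=1..N. c j * c k *
        (LINT x|lborel. (scaled_cutoff a \<alpha> lam x)\<^sup>2 * cos (lam * (x \<bullet> (\<xi> j - \<xi> k)))))"
proof -
  have pointwise: "(cmod (complex_of_real (scaled_cutoff a \<alpha> lam x) * plane_wave_sum lam N \<xi> c x))\<^sup>2
      = (\<Sum>j=1..N. \<Sum>k=1..N. c j * c k *
        ((scaled_cutoff a \<alpha> lam x)\<^sup>2 * cos (lam * (x \<bullet> (\<xi> j - \<xi> k)))))" for x
    by (simp add: norm_mult power_mult_distrib cmod_plane_wave_sum_square sum_distrib_left mult_ac)
  have "(L2_norm (\<lambda>x. complex_of_real (scaled_cutoff a \<alpha> lam x) * plane_wave_sum lam N \<xi> c x))\<^sup>2
      = (LINT x|lborel. (cmod (complex_of_real (scaled_cutoff a \<alpha> lam x) * plane_wave_sum lam N \<xi> c x))\<^sup>2)"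
    unfolding L2_norm_def by (intro real_sqrt_pow2 integral_nonneg_AE AE_I2) simp
  then show ?thesis
    unfolding pointwise using integrable_scaled_cutoff_square_cos[OF a lam] by simp
qed

theorem theorem0p3:
  fixes \<alpha> :: real and a :: "real \<Rightarrow> real"
  assumes "\<alpha> < 1" and "smooth_cutoff a"
  shows "\<exists>C1>0. \<exists>C2>0.
    \<forall>(lam::real) (\<gamma>::real) (N::nat) (p::real) (\<xi>::nat \<Rightarrow> real^2)
      (M::'w measure) (\<epsilon>::nat \<Rightarrow> 'w \<Rightarrow> real).
      1 \<le> lam \<longrightarrow> 0 < \<gamma> \<longrightarrow> 0 < N \<longrightarrow> real N = \<gamma> * lam \<longrightarrow> p \<in> {0..1} \<longrightarrow>
      equally_spaced_directions N \<xi> \<longrightarrow> prob_space M \<longrightarrow> random_signs M N p \<epsilon> \<longrightarrow>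
      prob_space.variance M
        (\<lambda>\<omega>. (L2_norm (\<lambda>x. complex_of_real (scaled_cutoff a \<alpha> lam x) *
                            plane_wave_sum lam N \<xi> (\<lambda>j. \<epsilon> j \<omega>) x))\<^sup>2)
      \<le> C1 * lam powr (1 - 3 * \<alpha>) * \<gamma>\<^sup>2 * (1 - (2 * p - 1)\<^sup>2)\<^sup>2
        + C2 * \<gamma> ^ 3 * lam powr (1 - 2 * \<alpha>) * (2 * p - 1)\<^sup>2 * (1 - (2 * p - 1)\<^sup>2)"
proof -
  obtain C where C: "C > 0"
    "\<And>\<alpha> lam z. lam > 0 \<Longrightarrow>
      \<bar>LINT x|lborel. (scaled_cutoff a \<alpha> lam x)\<^sup>2 * cos (lam * (x \<bullet> z))\<bar>
        \<le> C * lam powr (- 2 * \<alpha>) / (1 + (lam powr (1 - \<alpha>) * norm z)\<^sup>2)"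
    by (rule scaled_cutoff_square_transform_decay[OF assms(2)]) (rule that)
  have bound: "prob_space.variance M
        (\<lambda>\<omega>. (L2_norm (\<lambda>x. complex_of_real (scaled_cutoff a \<alpha> lam x) *
                            plane_wave_sum lam N \<xi> (\<lambda>j. \<epsilon> j \<omega>) x))\<^sup>2)
      \<le> (4 * C\<^sup>2) * lam powr (1 - 3 * \<alpha>) * \<gamma>\<^sup>2 * (1 - (2 * p - 1)\<^sup>2)\<^sup>2
        + (16 * C\<^sup>2) * \<gamma> ^ 3 * lam powr (1 - 2 * \<alpha>) * (2 * p - 1)\<^sup>2 * (1 - (2 * p - 1)\<^sup>2)"
    if lam1: "1 \<le> lam" and \<gamma>: "0 < \<gamma>" and N0: "0 < N" and N: "real N = \<gamma> * lam" and p: "p \<in> {0..1}"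
      and dirs: "equally_spaced_directions N \<xi>" and ps: "prob_space M" and signs: "random_signs M N p \<epsilon>"
    for lam \<gamma> p :: real and N and \<xi> :: "nat \<Rightarrow> real^2" and M :: "'w measure" and \<epsilon>
  proof -
    interpret prob_space M by (rule ps)
    have lam: "lam > 0" using lam1 by simp
    define A where "A j k =
      (LINT x|lborel. (scaled_cutoff a \<alpha> lam x)\<^sup>2 * cos (lam * (x \<bullet> (\<xi> j - \<xi> k))))" for j k
    \<comment> \<open>\<open>L\<close> bounds every entry. \<open>q\<close> converts circular index
      distance into a lower bound for the scaled frequency, with the 4 of the chord estimate.
      \<open>S\<close> is the resulting off-diagonal row bound \<open>L * (8 / q)\<close>,
      simplified with N = \<gamma> * lam.\<close>
    define L where "L = C * lam powr (- 2 * \<alpha>)"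
    define q where "q = 4 * lam powr (1 - \<alpha>) / real N"
    define S where "S = 2 * C * \<gamma> * lam powr (- \<alpha>)"
    have q0: "q > 0" and L0: "L \<ge> 0" and S0: "S \<ge> 0"
      using lam N0 C(1) \<gamma> by (simp_all add: q_def L_def S_def)
    have symA: "A j k = A k j" for j k
      unfolding A_def using cos_minus[of "lam * (x \<bullet> (\<xi> j - \<xi> k))" for x]
      by (simp add: inner_diff_right algebra_simps)
    have A1: "\<bar>A j k\<bar> \<le> L / (1 + (q * min \<bar>real j - real k\<bar> (real N - \<bar>real j - real k\<bar>))\<^sup>2)"
      if jk: "j \<in> {1..N}" "k \<in> {1..N}" for j k
    proof -
      let ?d = "min \<bar>real j - real k\<bar> (real N - \<bar>real j - real k\<bar>)"
      have d0: "?d \<ge> 0" using jk by auto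
      have "q * ?d = lam powr (1 - \<alpha>) * (4 * ?d / real N)" by (simp add: q_def)
      also have "\<dots> \<le> lam powr (1 - \<alpha>) * norm (\<xi> j - \<xi> k)"
        by (intro mult_left_mono equally_spaced_directions_norm_diff[OF dirs jk]) simp
      finally have "(q * ?d)\<^sup>2 \<le> (lam powr (1 - \<alpha>) * norm (\<xi> j - \<xi> k))\<^sup>2"
        using q0 d0 by (intro power_mono) auto
      then have "L / (1 + (lam powr (1 - \<alpha>) * norm (\<xi> j - \<xi> k))\<^sup>2) \<le> L / (1 + (q * ?d)\<^sup>2)"
        using L0 by (intro divide_left_mono) (auto intro!: mult_pos_pos add_pos_nonneg)
      then show ?thesis
        using C(2)[OF lam, of \<alpha> "\<xi> j - \<xi> k"] unfolding A_def L_def by linarith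
    qed
    have AL: "\<bar>A j k\<bar> \<le> L" if jk: "j \<in> {1..N}" "k \<in> {1..N}" for j k
    proof -
      have "L / (1 + x\<^sup>2) \<le> L / 1" for x :: real
        using L0 by (intro divide_left_mono) (auto intro!: add_pos_nonneg)
      then show ?thesis using A1[OF jk] by (metis div_by_1 order_trans)
    qed
    have row: "(\<Sum>k\<in>{1..N} - {j}. \<bar>A j k\<bar>) \<le> S" if j: "j \<in> {1..N}" for j
    proof -
      have "(\<Sum>k\<in>{1..N} - {j}. \<bar>A j k\<bar>) \<le> (\<Sum>k\<in>{1..N} - {j}.
          L * (1 / (1 + (q * min \<bar>real j - real k\<bar> (real N - \<bar>real j - real k\<bar>))\<^sup>2)))"
        using A1[OF j] by (intro sum_mono) simp
      also have "\<dots> \<le> L * (8 / q)"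
        unfolding sum_distrib_left[symmetric]
        by (intro mult_left_mono circular_distance_sum_le q0 j L0)
      also have "\<dots> = 2 * C * \<gamma> * (lam powr (- 2 * \<alpha>) * lam / lam powr (1 - \<alpha>))"
        using N0 lam by (simp add: L_def q_def N)
      also have "lam powr (- 2 * \<alpha>) * lam / lam powr (1 - \<alpha>) = lam powr (- \<alpha>)"
      proof -
        have "lam powr (- 2 * \<alpha>) * lam / lam powr (1 - \<alpha>) = lam powr (- 2 * \<alpha> + 1 - (1 - \<alpha>))"
          using lam unfolding powr_diff powr_add by simp
        then show ?thesis by simp
      qed
      finally show ?thesis by (simp add: S_def)
    qed
    \<comment> \<open>In each row one factor of the square is bounded by the entry bound
      \<open>L\<close> and the other is summed to at most \<open>S\<close>; the N = \<gamma> * lam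
      rows give N * L * S.\<close>
    have sq: "(\<Sum>j=1..N. \<Sum>k\<in>{1..N} - {j}. (A j k)\<^sup>2) \<le> 2 * C\<^sup>2 * lam powr (1 - 3 * \<alpha>) * \<gamma>\<^sup>2"
    proof -
      have "(\<Sum>k\<in>{1..N} - {j}. (A j k)\<^sup>2) \<le> L * S" if j: "j \<in> {1..N}" for j
      proof -
        have "(\<Sum>k\<in>{1..N} - {j}. (A j k)\<^sup>2) \<le> (\<Sum>k\<in>{1..N} - {j}. L * \<bar>A j k\<bar>)"
        proof (rule sum_mono)
          fix k assume "k \<in> {1..N} - {j}"
          then have "\<bar>A j k\<bar> * \<bar>A j k\<bar> \<le> L * \<bar>A j k\<bar>"
            using AL[OF j, of k] by (intro mult_right_mono) auto
          then show "(A j k)\<^sup>2 \<le> L * \<bar>A j k\<bar>" by (simp add: power2_eq_square)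
        qed
        also have "\<dots> \<le> L * S"
          unfolding sum_distrib_left[symmetric] by (intro mult_left_mono row j L0)
        finally show ?thesis .
      qed
      then have "(\<Sum>j=1..N. \<Sum>k\<in>{1..N} - {j}. (A j k)\<^sup>2) \<le> (\<Sum>j=1..N. L * S)"
        by (rule sum_mono)
      also have "\<dots> = 2 * C\<^sup>2 * \<gamma>\<^sup>2 * (lam * lam powr (- 2 * \<alpha>) * lam powr (- \<alpha>))"
        by (simp add: N L_def S_def power2_eq_square)
      also have "lam * lam powr (- 2 * \<alpha>) * lam powr (- \<alpha>) = lam powr (1 + - 2 * \<alpha> + - \<alpha>)"
        using lam unfolding powr_add by simp
      also have "1 + - 2 * \<alpha> + - \<alpha> = 1 - 3 * \<alpha>" by simp
      finally show ?thesis by (simp add: mult_ac)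
    qed
    \<comment> \<open>Here the entire row sum is squared, so the N rows give N * S^2, whence the
      third power of \<gamma>.\<close>
    have lin: "(\<Sum>j=1..N. (\<Sum>k\<in>{1..N} - {j}. A j k)\<^sup>2) \<le> 4 * C\<^sup>2 * \<gamma> ^ 3 * lam powr (1 - 2 * \<alpha>)"
    proof -
      have "(\<Sum>k\<in>{1..N} - {j}. A j k)\<^sup>2 \<le> S\<^sup>2" if j: "j \<in> {1..N}" for j
        using order_trans[OF sum_abs row[OF j]] S0 by (simp add: abs_le_square_iff[symmetric])
      then have "(\<Sum>j=1..N. (\<Sum>k\<in>{1..N} - {j}. A j k)\<^sup>2) \<le> (\<Sum>j=1..N. S\<^sup>2)"
        by (rule sum_mono)
      also have "\<dots> = 4 * C\<^sup>2 * \<gamma> ^ 3 * (lam * lam powr (- \<alpha>) * lam powr (- \<alpha>))"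
        by (simp add: N S_def power2_eq_square power3_eq_cube)
      also have "lam * lam powr (- \<alpha>) * lam powr (- \<alpha>) = lam powr (1 + - \<alpha> + - \<alpha>)"
        using lam unfolding powr_add by simp
      also have "1 + - \<alpha> + - \<alpha> = 1 - 2 * \<alpha>" by simp
      finally show ?thesis .
    qed
    let ?m = "2 * p - 1"
    have "\<bar>?m\<bar> \<le> 1" using p by auto
    \<comment> \<open>Nonnegativity of the sign variance lets the two matrix bounds be multiplied by
      their coefficients.\<close>
    then have v0: "0 \<le> 1 - ?m\<^sup>2" by (simp add: abs_square_le_1)
    have ind: "indep_vars (\<lambda>_. borel) \<epsilon> {1..N}" using signs by (simp add: random_signs_def)
    have "variance (\<lambda>\<omega>. (L2_norm (\<lambda>x. complex_of_real (scaled_cutoff a \<alpha> lam x) *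
            plane_wave_sum lam N \<xi> (\<lambda>j. \<epsilon> j \<omega>) x))\<^sup>2)
        = variance (\<lambda>\<omega>. \<Sum>j=1..N. \<Sum>k=1..N. \<epsilon> j \<omega> * \<epsilon> k \<omega> * A j k)"
      unfolding L2_norm_cutoff_plane_wave_sum[OF assms(2) lam] A_def ..
    also have "\<dots> = 2 * (1 - ?m\<^sup>2)\<^sup>2 * (\<Sum>j=1..N. \<Sum>k\<in>{1..N} - {j}. (A j k)\<^sup>2)
        + 4 * ?m\<^sup>2 * (1 - ?m\<^sup>2) * (\<Sum>j=1..N. (\<Sum>k\<in>{1..N} - {j}. A j k)\<^sup>2)"
      by (rule variance_sign_quadratic_form[OF _ ind random_signs_moments[OF signs] symA]) auto
    also have "\<dots> \<le> 2 * (1 - ?m\<^sup>2)\<^sup>2 * (2 * C\<^sup>2 * lam powr (1 - 3 * \<alpha>) * \<gamma>\<^sup>2)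
        + 4 * ?m\<^sup>2 * (1 - ?m\<^sup>2) * (4 * C\<^sup>2 * \<gamma> ^ 3 * lam powr (1 - 2 * \<alpha>))"
      using v0 by (intro add_mono mult_left_mono sq lin) auto
    finally show ?thesis by (simp add: mult_ac)
  qed
  show ?thesis
    \<comment> \<open>The constants are 2 * 2 and 4 * 4 times C^2: the coefficients of the variance
      formula times those of the bounds \<open>sq\<close> and \<open>lin\<close>.\<close>
    by (rule exI[of _ "4 * C\<^sup>2"], rule conjI, simp add: C(1) less_imp_neq[symmetric],
        rule exI[of _ "16 * C\<^sup>2"]) (use C(1) bound in auto)
qed

end
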